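(* Let $b,c,f$ be analytic data on $[0,1]$ as described in the context (with fixed data constants). Then there exist positive constants $C,K$, independent of $\varepsilon_1,\varepsilon_2$ and $u$, such that for all $0<\varepsilon_1\le\varepsilon_2\le 1$ with $c(x)-\frac{\varepsilon_2}{2}b'(x)\ge\rho$ on $[0,1]$, the solution $u$ of $$-\varepsilon_1u''(x)+\varepsilon_2b(x)u'(x)+c(x)u(x)=f(x),\quad x\in(0,1),\qquad u(0)=u(1)=0,$$ satisfies for every $n=0,1,2,\dots$ $$\|u^{(n)}\|_{\infty,I}\le C K^{n}\max\{n,\varepsilon_1^{-1}\}^{n}.$$
   Context: $I=(0,1)$ and $\|\cdot\|_{\infty,I}$ is the $L^\infty(I)$ norm. The data $b,c,f$ are real functions, independent of $\varepsilon_1,\varepsilon_2$, analytic on $[0,1]$ in the sense that there are positive constants $C_0,\gamma_f,\gamma_c,\gamma_b$ independent of $\varepsilon_1,\varepsilon_2$ with $\|f^{(n)}\|_{\infty,I}\le C_0 n!\gamma_f^n$, $\|c^{(n)}\|_{\infty,I}\le C_0n!\gamma_c^n$, $\|b^{(n)}\|_{\infty,I}\le C_0n!\gamma_b^n$ for all $n=0,1,2,\dots$. Moreover there are constants $\beta_0,\gamma,\rho>0$ independent of $\varepsilon_1,\varepsilon_2$ such that for all $x\in[0,1]$: $b(x)\ge\beta_0$, $c(x)\ge\gamma$, and $c(x)-\frac{\varepsilon_2}{2}b'(x)\ge\rho$. *)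

theory Defs
  imports "HOL-Analysis.Analysis" "HOL-Probability.Essential_Supremum"
begin

definition Linf_norm :: "(real \<Rightarrow> real) \<Rightarrow> ereal" where
  "Linf_norm g = esssup (lebesgue_on {0<..<1}) (\<lambda>x. ereal \<bar>g x\<bar>)"

text \<open>
  All derivatives are taken relative to \<open>[0,1]\<close>: they are the ordinary derivatives in
  \<open>(0,1)\<close> and the one-sided ones at the endpoints, and values of the
  function outside \<open>[0,1]\<close> play no role.
\<close>

definition nderiv :: "nat \<Rightarrow> (real \<Rightarrow> real) \<Rightarrow> real \<Rightarrow> real" where
  "nderiv n g = ((\<lambda>h x. vector_derivative h (at x within {0..1})) ^^ n) g"

lemma nderiv_eq_deriv:
  assumes "x \<in> {0<..<1}"
  shows "nderiv n g x = (deriv ^^ n) g x"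
  using assms
proof (induction n arbitrary: x)
  case 0
  then show ?case by (simp add: nderiv_def)
next
  case (Suc n)
  have I: "at x within {0..1} = at x"
    using Suc.prems by (intro at_within_interior) simp
  have ev: "eventually (\<lambda>y. nderiv n g y = (deriv ^^ n) g y) (nhds x)"
    using Suc by (intro eventually_nhds_in_open[THEN eventually_mono, of "{0<..<1}"]) auto
  have "nderiv (Suc n) g x = deriv (nderiv n g) x"
    by (simp add: nderiv_def I vector_derivative_def deriv_def
        has_real_derivative_iff_has_vector_derivative)
  also have "\<dots> = deriv ((deriv ^^ n) g) x"
    using ev by (rule deriv_cong_ev) simp
  finally show ?case by simp
qed

text \<open>
  Differentiability of each iterated derivative is required explicitly because
  \<^const>\<open>vector_derivative\<close> is total. The bound uses the norm on the open interval.
\<close>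

definition analytic_data :: "real \<Rightarrow> real \<Rightarrow> (real \<Rightarrow> real) \<Rightarrow> bool" where
  "analytic_data C0 \<gamma> g \<longleftrightarrow>
     (\<forall>n. nderiv n g differentiable_on {0..1}) \<and>
     (\<forall>n. Linf_norm (nderiv n g) \<le> ereal (C0 * fact n * \<gamma> ^ n))"

definition bvp_solution ::
  "real \<Rightarrow> real \<Rightarrow> (real \<Rightarrow> real) \<Rightarrow> (real \<Rightarrow> real) \<Rightarrow> (real \<Rightarrow> real) \<Rightarrow> (real \<Rightarrow> real) \<Rightarrow> bool" where
  "bvp_solution \<epsilon>1 \<epsilon>2 b c f u \<longleftrightarrow>
     continuous_on {0..1} u \<and>
     u differentiable_on {0<..<1} \<and>
     nderiv 1 u differentiable_on {0<..<1} \<and>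
     (\<forall>x\<in>{0<..<1}. - \<epsilon>1 * nderiv 2 u x + \<epsilon>2 * b x * nderiv 1 u x + c x * u x = f x) \<and>
     u 0 = 0 \<and> u 1 = 0"

end

theory Submission
  imports Defs
begin

text \<open>
  The maximum principle gives \<open>\<bar>u\<bar> \<le> C0 / \<gamma>\<close>. By Rolle, \<open>u'\<close> vanishes somewhere, and
  \<open>\<epsilon>1 * u' - \<epsilon>2 * b * u\<close> has the derivative \<open>c * u - f - \<epsilon>2 * b' * u\<close>, which is bounded
  uniformly in the parameters, so \<open>\<epsilon>1 * u'\<close> is bounded as well. The higher
  derivatives are then bounded by induction, differentiating the equation with Leibniz's rule
  and using that \<open>(n choose k) * k! \<le> n ^ k\<close>, which turns the sums into geometric ones.
\<close>

section \<open>Essential suprema of continuous functions, and iterated derivatives\<close>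

text \<open>The set of points of \<open>S\<close> with \<open>B < g y\<close> is open by continuity
  and null by assumption, and a nonempty open set is never negligible.\<close>

lemma AE_bound_imp_bound:
  fixes g :: "real \<Rightarrow> real"
  assumes S: "open S" and g: "continuous_on S g"
    and AE: "AE y in lebesgue_on S. g y \<le> B" and x: "x \<in> S"
  shows "g x \<le> B"
proof (rule ccontr)
  assume "\<not> g x \<le> B"
  let ?U = "{y \<in> S. B < g y}"
  have "?U = S \<inter> g -` {B<..}"
    by auto
  then have U: "open ?U"
    using continuous_open_preimage[OF g S, of "{B<..}"] by simp
  have "AE y in lebesgue. y \<in> S \<longrightarrow> g y \<le> B"
    using AE S by (subst (asm) AE_restrict_space_iff) auto
  then have "AE y in lebesgue. y \<notin> ?U"
    by eventually_elim auto
  then have "?U \<in> null_sets lebesgue"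
    using U by (subst AE_iff_null_sets) auto
  then have "negligible ?U"
    by (simp add: negligible_iff_null_sets)
  then have "?U = {}"
    using U open_not_negligible by blast
  with x \<open>\<not> g x \<le> B\<close> show False
    by auto
qed

lemma Linf_norm_le_imp_bound:
  assumes "continuous_on {0<..<1} g" and "Linf_norm g \<le> ereal B" and "x \<in> {0<..<1}"
  shows "\<bar>g x\<bar> \<le> B"
proof -
  have "AE y in lebesgue_on {0<..<1}. ereal \<bar>g y\<bar> \<le> Linf_norm g"
    unfolding Linf_norm_def by (rule esssup_AE)
  then have "AE y in lebesgue_on {0<..<1}. \<bar>g y\<bar> \<le> B"
  proof eventually_elim
    case (elim y)
    then have "ereal \<bar>g y\<bar> \<le> ereal B"
      using assms(2) by (rule order_trans)
    then show ?case by simp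
  qed
  then show ?thesis
    using assms by (intro AE_bound_imp_bound[of "{0<..<1}" "\<lambda>y. \<bar>g y\<bar>"])
      (auto intro!: continuous_intros)
qed

lemma Linf_norm_leI:
  assumes "continuous_on {0<..<1} g" and "\<And>x. x \<in> {0<..<1} \<Longrightarrow> \<bar>g x\<bar> \<le> B"
  shows "Linf_norm g \<le> ereal B"
  unfolding Linf_norm_def
proof (rule esssup_I)
  have "g \<in> borel_measurable (lebesgue_on {0<..<1})"
    using assms(1) by (intro continuous_imp_measurable_on_sets_lebesgue) auto
  then show "(\<lambda>x. ereal \<bar>g x\<bar>) \<in> borel_measurable (lebesgue_on {0<..<1})"
    by measurable
  show "AE x in lebesgue_on {0<..<1}. ereal \<bar>g x\<bar> \<le> ereal B"
    using assms(2) by (intro AE_I2) simp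
qed

lemma nderiv_0: "nderiv 0 g = g"
  by (simp add: nderiv_def)

text \<open>At an interior point \<open>at x within {0..1}\<close> is \<open>at x\<close>, so the
  total \<open>vector_derivative\<close> is a genuine derivative once differentiability is
  known.\<close>

lemma nderiv_has_derivative:
  assumes "nderiv n g differentiable_on {0<..<1}" and x: "x \<in> {0<..<1}"
  shows "(nderiv n g has_real_derivative nderiv (Suc n) g x) (at x)"
proof -
  have I: "at x within {0..1} = at x"
    using x by (intro at_within_interior) simp
  have "nderiv n g differentiable (at x)"
    using assms by (simp add: differentiable_on_eq_differentiable_at)
  then have "(nderiv n g has_vector_derivative vector_derivative (nderiv n g) (at x)) (at x)"
    by (simp add: vector_derivative_works)
  then show ?thesis
    by (simp add: nderiv_def I has_real_derivative_iff_has_vector_derivative)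
qed

lemma analytic_data_has_derivative:
  assumes "analytic_data C0 r g" and "x \<in> {0<..<1}"
  shows "(nderiv n g has_real_derivative nderiv (Suc n) g x) (at x)"
  using assms unfolding analytic_data_def
  by (intro nderiv_has_derivative) (auto intro: differentiable_on_subset)

lemma analytic_data_bound:
  assumes "analytic_data C0 r g" and "x \<in> {0<..<1}"
  shows "\<bar>nderiv n g x\<bar> \<le> C0 * fact n * r ^ n"
proof (rule Linf_norm_le_imp_bound[of "nderiv n g"])
  show "continuous_on {0<..<1} (nderiv n g)"
    using assms(1) unfolding analytic_data_def
    by (intro continuous_on_subset[OF differentiable_imp_continuous_on, of _ "{0..1}"]) auto
qed (use assms in \<open>auto simp: analytic_data_def\<close>)

section \<open>Leibniz's rule and its geometric estimate\<close>

text \<open>If \<open>p k\<close> and \<open>q k\<close> are the \<open>k\<close>-th derivatives of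
  two functions, this is the \<open>n\<close>-th derivative of their product. Working with families
  allows a shifted one, such as the derivatives of \<open>u'\<close>, to be inserted
  directly.\<close>

definition leibniz_sum ::
  "nat \<Rightarrow> (nat \<Rightarrow> real \<Rightarrow> real) \<Rightarrow> (nat \<Rightarrow> real \<Rightarrow> real) \<Rightarrow> real \<Rightarrow> real" where
  "leibniz_sum n p q x = (\<Sum>k\<le>n. real (n choose k) * (p k x * q (n - k) x))"

text \<open>This is Pascal's rule, arranged so that the right-hand side is what the product rule
  yields term by term.\<close>

lemma leibniz_sum_Suc:
  "leibniz_sum (Suc n) p q x =
     (\<Sum>k\<le>n. real (n choose k) * (p (Suc k) x * q (n - k) x + p k x * q (Suc (n - k)) x))"
proof -
  \<comment> \<open>The additional term \<open>k = Suc n\<close> vanishes since its binomial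
    coefficient is 0. The next fact splits \<open>k = 0\<close> off the same sum; comparing the two
    expressions gives Pascal's rule.\<close>
  have "(\<Sum>k\<le>Suc n. real (n choose k) * (p k x * q (Suc n - k) x)) =
      (\<Sum>k\<le>n. real (n choose k) * (p k x * q (Suc (n - k)) x))"
    by (simp add: Suc_diff_le)
  moreover have "(\<Sum>k\<le>Suc n. real (n choose k) * (p k x * q (Suc n - k) x)) =
      p 0 x * q (Suc n) x
      + (\<Sum>k\<le>n. real (n choose Suc k) * (p (Suc k) x * q (n - k) x))"
    by (simp add: sum.atMost_Suc_shift del: sum.atMost_Suc)
  moreover have "leibniz_sum (Suc n) p q x =
      p 0 x * q (Suc n) x
      + (\<Sum>k\<le>n. real (n choose Suc k) * (p (Suc k) x * q (n - k) x))
      + (\<Sum>k\<le>n. real (n choose k) * (p (Suc k) x * q (n - k) x))"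
    by (simp add: leibniz_sum_def sum.atMost_Suc_shift sum.distrib algebra_simps
        del: sum.atMost_Suc)
  ultimately show ?thesis
    by (simp add: sum.distrib algebra_simps)
qed

text \<open>Only orders up to \<open>n\<close> are required to be differentiable, so the rule can be
  applied while the smoothness of \<open>u\<close> is still being established order by
  order.\<close>

lemma leibniz_sum_has_derivative:
  assumes "\<And>k. k \<le> n \<Longrightarrow> (p k has_real_derivative p (Suc k) x) (at x)"
    and "\<And>k. k \<le> n \<Longrightarrow> (q k has_real_derivative q (Suc k) x) (at x)"
  shows "(leibniz_sum n p q has_real_derivative leibniz_sum (Suc n) p q x) (at x)"
proof -
  have "((\<lambda>y. real (n choose k) * (p k y * q (n - k) y)) has_real_derivative
      real (n choose k) * (p (Suc k) x * q (n - k) x + p k x * q (Suc (n - k)) x)) (at x)"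
    if "k \<le> n" for k
    using assms(1)[of k] assms(2)[of "n - k"] that
    by (auto intro!: derivative_eq_intros)
  then show ?thesis
    unfolding leibniz_sum_Suc unfolding leibniz_sum_def by (intro DERIV_sum) auto
qed

text \<open>The left-hand side is the falling factorial of \<open>n\<close>, a product of
  \<open>k\<close> factors each at most \<open>n\<close>.\<close>

lemma choose_mult_fact_le_power: "real (n choose k) * fact k \<le> real n ^ k"
proof -
  have "(n choose k) * fact k \<le> n ^ k"
    by (metis binomial_eq_0 binomial_fact_pow fact_binomial mult.commute)
  then show ?thesis
    by (metis of_nat_fact of_nat_le_iff of_nat_mult of_nat_power)
qed

text \<open>The binomial coefficient and \<open>fact k\<close> together are at most
  \<open>m ^ k\<close>, which restores the full power of \<open>m\<close>. Since
  \<open>r \<le> K / 2\<close>, the \<open>k\<close>-th term carries a factor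
  \<open>(1/2) ^ k\<close>, and the geometric sum costs only a factor 2, whatever \<open>n\<close>
  is.\<close>

lemma leibniz_sum_bound:
  assumes p: "\<And>k. k \<le> n \<Longrightarrow> \<bar>p k x\<bar> \<le> A * fact k * r ^ k"
    and q: "\<And>j. j \<le> n \<Longrightarrow> \<bar>q j x\<bar> \<le> E * (K * m) ^ j"
    and A: "0 \<le> A" and r: "0 \<le> r" "2 * r \<le> K" and K: "0 < K"
    and E: "0 \<le> E" and m: "real n \<le> m"
  shows "\<bar>leibniz_sum n p q x\<bar> \<le> 2 * A * E * (K * m) ^ n"
proof -
  have m0: "0 \<le> m"
    using m by linarith
  have "\<bar>real (n choose k) * (p k x * q (n - k) x)\<bar> \<le> A * E * (K * m) ^ n * (1/2) ^ k"
    if k: "k \<le> n" for k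
  proof -
    have "\<bar>real (n choose k) * (p k x * q (n - k) x)\<bar>
        \<le> real (n choose k) * ((A * fact k * r ^ k) * (E * (K * m) ^ (n - k)))"
      using p[OF k] q[of "n - k"] A r unfolding abs_mult
      by (intro mult_mono) auto
    also have "\<dots> = (real (n choose k) * fact k) * (A * E * (K * m) ^ (n - k) * r ^ k)"
      by simp
    also have "\<dots> \<le> m ^ k * (A * E * (K * m) ^ (n - k) * (K / 2) ^ k)"
    proof (intro mult_mono)
      show "real (n choose k) * fact k \<le> m ^ k"
        using choose_mult_fact_le_power[of n k] power_mono[OF m, of k] by simp
      show "r ^ k \<le> (K / 2) ^ k"
        using r by (intro power_mono) auto
    qed (use A E K m0 r in auto)
    also have "\<dots> = A * E * ((K * m) ^ (n - k) * (K * m) ^ k) * (1/2) ^ k"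
      by (simp add: power_mult_distrib power_divide field_simps)
    also have "\<dots> = A * E * (K * m) ^ n * (1/2) ^ k"
      using k by (simp flip: power_add)
    finally show ?thesis .
  qed
  then have "\<bar>leibniz_sum n p q x\<bar> \<le> (\<Sum>k\<le>n. A * E * (K * m) ^ n * (1/2) ^ k)"
    unfolding leibniz_sum_def by (intro order_trans[OF sum_abs] sum_mono) auto
  also have "\<dots> = A * E * (K * m) ^ n * (\<Sum>k\<le>n. (1/2) ^ k)"
    by (simp add: sum_distrib_left)
  also have "\<dots> \<le> A * E * (K * m) ^ n * 2"
  proof (intro mult_left_mono)
    show "(\<Sum>k\<le>n. (1/2 :: real) ^ k) \<le> 2"
      by (simp add: sum_gp0)
  qed (use A E K m0 in auto)
  finally show ?thesis
    by (simp add: mult_ac)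
qed

section \<open>Maximum principle\<close>

text \<open>At the maximum \<open>v x = 0\<close>. If \<open>l\<close> were positive,
  \<open>v\<close> would be positive just to the right of \<open>x\<close>, so \<open>u\<close>
  would strictly increase there. Differentiability of \<open>v\<close> at the single point
  \<open>x\<close> suffices for this.\<close>

lemma second_derivative_nonpos_at_max:
  fixes u v :: "real \<Rightarrow> real"
  assumes "open S" and x: "x \<in> S"
    and u: "\<And>y. y \<in> S \<Longrightarrow> (u has_real_derivative v y) (at y)"
    and v: "(v has_real_derivative l) (at x)"
    and max: "\<And>y. y \<in> S \<Longrightarrow> u y \<le> u x"
  shows "l \<le> 0"
proof (rule ccontr)
  assume "\<not> l \<le> 0"
  then obtain d where d: "d > 0" "\<And>h. 0 < h \<Longrightarrow> h < d \<Longrightarrow> v x < v (x + h)"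
    using DERIV_pos_inc_right[OF v] by force
  obtain e where e: "e > 0" "ball x e \<subseteq> S"
    using \<open>open S\<close> x openE by blast
  have "v x = 0"
    using e max by (intro DERIV_local_max[OF u[OF x] \<open>e > 0\<close>])
      (auto simp: subset_iff dist_real_def)
  \<comment> \<open>Halving keeps \<open>{x..x + h}\<close> inside \<open>S\<close> and inside the
    range where \<open>v\<close> exceeds \<open>v x\<close>.\<close>
  define h where "h = min d e / 2"
  have h: "0 < h" "h < d" "h < e"
    using d(1) e(1) by (auto simp: h_def)
  have S: "y \<in> S" if "x \<le> y" "y \<le> x + h" for y
    using that h e(2) by (auto simp: subset_iff dist_real_def)
  have "u x < u (x + h)"
  proof (rule DERIV_pos_imp_increasing_open[of x "x + h" u])
    fix y assume "x < y" "y < x + h"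
    then show "\<exists>D. (u has_real_derivative D) (at y) \<and> 0 < D"
      using u[OF S, of y] d(2)[of "y - x"] h \<open>v x = 0\<close> by (intro exI[of _ "v y"]) auto
  next
    show "continuous_on {x..x + h} u"
      by (intro continuous_at_imp_continuous_on ballI DERIV_isCont[OF u] S) auto
  qed (use h in simp)
  then show False
    using max[OF S, of "x + h"] h by auto
qed

text \<open>At a positive interior maximum \<open>z\<close> the first-order term vanishes and
  \<open>- e * w z\<close> is nonnegative, so the equation leaves
  \<open>c z * u z \<le> f z\<close>, which bounds \<open>u z\<close> through
  \<open>\<gamma> \<le> c z\<close>.\<close>

lemma maximum_principle:
  fixes a b c f u v w :: "real \<Rightarrow> real"
  assumes u: "continuous_on {0..1} u" and u0: "u 0 = 0" "u 1 = 0"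
    and du: "\<And>x. x \<in> {0<..<1} \<Longrightarrow> (u has_real_derivative v x) (at x)"
    and dv: "\<And>x. x \<in> {0<..<1} \<Longrightarrow> (v has_real_derivative w x) (at x)"
    and eq: "\<And>x. x \<in> {0<..<1} \<Longrightarrow> - e * w x + a x * v x + c x * u x = f x"
    and e: "0 < e" and \<gamma>: "0 < \<gamma>"
    and c: "\<And>x. x \<in> {0<..<1} \<Longrightarrow> \<gamma> \<le> c x"
    and f: "\<And>x. x \<in> {0<..<1} \<Longrightarrow> f x \<le> A" and A: "0 \<le> A"
    and x: "x \<in> {0..1}"
  shows "u x \<le> A / \<gamma>"
proof (rule ccontr)
  assume gt: "\<not> u x \<le> A / \<gamma>"
  obtain z where z: "z \<in> {0..1}" and max: "\<And>y. y \<in> {0..1} \<Longrightarrow> u y \<le> u z"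
    using continuous_attains_sup[of "{0..1}" u] u by auto
  have uz: "A / \<gamma> < u z"
    using gt max[OF x] by simp
  \<comment> \<open>Strict positivity keeps \<open>z\<close> away from the endpoints, where
    \<open>u\<close> is 0.\<close>
  then have "0 < u z"
    using A \<gamma> by (meson divide_nonneg_pos le_less_trans)
  then have "z \<noteq> 0" "z \<noteq> 1"
    using u0 by auto
  with z have z: "z \<in> {0<..<1}"
    by auto
  have "w z \<le> 0"
    using z du dv[OF z] max by (intro second_derivative_nonpos_at_max[of "{0<..<1}" z u v]) auto
  then have "e * w z \<le> 0"
    using e by (simp add: mult_nonneg_nonpos)
  moreover have "v z = 0"
  proof (rule DERIV_local_max[OF du[OF z], of "min z (1 - z)"])
    show "\<forall>y. \<bar>z - y\<bar> < min z (1 - z) \<longrightarrow> u y \<le> u z"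
    proof (intro allI impI max)
      fix y assume "\<bar>z - y\<bar> < min z (1 - z)"
      then show "y \<in> {0..1}" by (simp add: abs_if split: if_splits)
    qed
  qed (use z in auto)
  ultimately have "c z * u z \<le> f z"
    using eq[OF z] by auto
  moreover have "\<gamma> * u z \<le> c z * u z"
    using c[OF z] \<open>0 < u z\<close> by (intro mult_right_mono) auto
  moreover have "A < \<gamma> * u z"
    using uz \<gamma> by (simp add: field_simps)
  ultimately show False
    using f[OF z] by linarith
qed

text \<open>The equation is linear, so the one-sided bound applies to \<open>- u\<close> with
  right-hand side \<open>- f\<close> as well.\<close>

lemma maximum_principle_abs:
  fixes a b c f u v w :: "real \<Rightarrow> real"
  assumes u: "continuous_on {0..1} u" and u0: "u 0 = 0" "u 1 = 0"
    and du: "\<And>x. x \<in> {0<..<1} \<Longrightarrow> (u has_real_derivative v x) (at x)"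
    and dv: "\<And>x. x \<in> {0<..<1} \<Longrightarrow> (v has_real_derivative w x) (at x)"
    and eq: "\<And>x. x \<in> {0<..<1} \<Longrightarrow> - e * w x + a x * v x + c x * u x = f x"
    and e: "0 < e" and \<gamma>: "0 < \<gamma>"
    and c: "\<And>x. x \<in> {0<..<1} \<Longrightarrow> \<gamma> \<le> c x"
    and f: "\<And>x. x \<in> {0<..<1} \<Longrightarrow> \<bar>f x\<bar> \<le> A" and A: "0 \<le> A"
    and x: "x \<in> {0..1}"
  shows "\<bar>u x\<bar> \<le> A / \<gamma>"
proof -
  have "u x \<le> A / \<gamma>"
    using f by (intro maximum_principle[OF u u0 du dv eq e \<gamma> c _ A x]) (auto simp: abs_le_iff)
  moreover have "- u x \<le> A / \<gamma>"
  proof (rule maximum_principle[of "\<lambda>x. - u x" "\<lambda>x. - v x" "\<lambda>x. - w x" e a c "\<lambda>x. - f x",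
        OF _ _ _ _ _ _ e \<gamma> c _ A x])
    fix y :: real assume y: "y \<in> {0<..<1}"
    show "((\<lambda>x. - u x) has_real_derivative - v y) (at y)"
      by (intro DERIV_minus du y)
    show "((\<lambda>x. - v x) has_real_derivative - w y) (at y)"
      by (intro DERIV_minus dv y)
    show "- e * - w y + a y * - v y + c y * - u y = - f y"
      using eq[OF y] by simp
    show "- f y \<le> A"
      using f[OF y] by simp
  qed (use u u0 in \<open>auto intro!: continuous_intros\<close>)
  ultimately show ?thesis
    by simp
qed

section \<open>First derivative, and smoothness of the solution\<close>

text \<open>Absorbing \<open>e2 * b * v\<close> into a total derivative leaves a right-hand side
  free of \<open>v\<close>. In the bound, \<open>A * M + F + B' * M\<close> controls the derivative
  of \<open>G\<close>, and \<open>2 * (B * M)\<close> controls the term \<open>e2 * (b * u)\<close>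
  at \<open>x\<close> and at the zero \<open>z\<close> of \<open>v\<close>.\<close>

lemma first_derivative_bound:
  fixes b b' c f u v w :: "real \<Rightarrow> real"
  assumes u: "continuous_on {0..1} u" and u0: "u 0 = 0" "u 1 = 0"
    and du: "\<And>x. x \<in> {0<..<1} \<Longrightarrow> (u has_real_derivative v x) (at x)"
    and dv: "\<And>x. x \<in> {0<..<1} \<Longrightarrow> (v has_real_derivative w x) (at x)"
    and db: "\<And>x. x \<in> {0<..<1} \<Longrightarrow> (b has_real_derivative b' x) (at x)"
    and eq: "\<And>x. x \<in> {0<..<1} \<Longrightarrow> - e1 * w x + e2 * b x * v x + c x * u x = f x"
    and e: "0 < e1" "0 \<le> e2" "e2 \<le> 1"
    and uM: "\<And>x. x \<in> {0<..<1} \<Longrightarrow> \<bar>u x\<bar> \<le> M"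
    and bB: "\<And>x. x \<in> {0<..<1} \<Longrightarrow> \<bar>b x\<bar> \<le> B"
    and b'B: "\<And>x. x \<in> {0<..<1} \<Longrightarrow> \<bar>b' x\<bar> \<le> B'"
    and cB: "\<And>x. x \<in> {0<..<1} \<Longrightarrow> \<bar>c x\<bar> \<le> A"
    and fB: "\<And>x. x \<in> {0<..<1} \<Longrightarrow> \<bar>f x\<bar> \<le> F"
    and x: "x \<in> {0<..<1}"
  shows "\<bar>v x\<bar> \<le> (A * M + F + B' * M + 2 * (B * M)) / e1"
proof -
  obtain z where z: "z \<in> {0<..<1}" "v z = 0"
  proof -
    have "\<exists>z>0. z < 1 \<and> (u has_real_derivative 0) (at z)"
      using u u0 du by (intro Rolle) (auto simp: real_differentiable_def)
    then show thesis
      using that du by (metis DERIV_unique greaterThanLessThan_iff)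
  qed
  define G where "G y = e1 * v y - e2 * (b y * u y)" for y
  have dG: "(G has_real_derivative (c y * u y - f y - e2 * (b' y * u y))) (at y)"
    if y: "y \<in> {0<..<1}" for y
    unfolding G_def using eq[OF y]
    by (auto intro!: derivative_eq_intros du[OF y] dv[OF y] db[OF y] simp: algebra_simps)
  have bd: "\<bar>c y * u y - f y - e2 * (b' y * u y)\<bar> \<le> A * M + F + B' * M"
    if y: "y \<in> {0<..<1}" for y
  proof -
    have "\<bar>c y * u y\<bar> \<le> A * M"
      unfolding abs_mult using uM[OF y] cB[OF y] by (intro mult_mono) auto
    moreover have "\<bar>b' y * u y\<bar> \<le> B' * M"
      unfolding abs_mult using uM[OF y] b'B[OF y] by (intro mult_mono) auto
    moreover have "\<bar>e2 * (b' y * u y)\<bar> \<le> \<bar>b' y * u y\<bar>"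
      using e by (simp add: abs_mult mult_left_le_one_le)
    ultimately show ?thesis
      using fB[OF y] by linarith
  qed
  have bu: "\<bar>e2 * (b y * u y)\<bar> \<le> B * M" if y: "y \<in> {0<..<1}" for y
  proof -
    have "\<bar>b y * u y\<bar> \<le> B * M"
      unfolding abs_mult using uM[OF y] bB[OF y] by (intro mult_mono) auto
    moreover have "\<bar>e2 * (b y * u y)\<bar> \<le> \<bar>b y * u y\<bar>"
      using e by (simp add: abs_mult mult_left_le_one_le)
    ultimately show ?thesis
      by linarith
  qed
  have "norm (G x - G z) \<le> (A * M + F + B' * M) * norm (x - z)"
    using dG bd x z(1)
    by (intro field_differentiable_bound[of "{0<..<1}" G])
      (auto intro: has_field_derivative_at_within)
  \<comment> \<open>Both points lie in the unit interval, so their distance is at most 1.\<close>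
  also have "\<dots> \<le> (A * M + F + B' * M) * 1"
    using bd[OF x] x z(1) by (intro mult_left_mono) auto
  finally have "\<bar>G x - G z\<bar> \<le> A * M + F + B' * M"
    by simp
  then have "\<bar>e1 * v x\<bar> \<le> A * M + F + B' * M + 2 * (B * M)"
    using bu[OF x] bu[OF z(1)] z(2) unfolding G_def by auto
  then show ?thesis
    using e by (simp add: abs_mult field_simps)
qed

text \<open>A bootstrap: solved for the highest derivative, the equation expresses it by lower
  derivatives that are already differentiable, so it is differentiable too and the equation may be
  differentiated again.\<close>

lemma bvp_solution_derivatives:
  assumes sol: "bvp_solution \<epsilon>1 \<epsilon>2 b c f u" and e1: "0 < \<epsilon>1"
    and b: "\<And>n x. x \<in> {0<..<1} \<Longrightarrow> (nderiv n b has_real_derivative nderiv (Suc n) b x) (at x)"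
    and c: "\<And>n x. x \<in> {0<..<1} \<Longrightarrow> (nderiv n c has_real_derivative nderiv (Suc n) c x) (at x)"
    and f: "\<And>n x. x \<in> {0<..<1} \<Longrightarrow> (nderiv n f has_real_derivative nderiv (Suc n) f x) (at x)"
    and x: "x \<in> {0<..<1}"
  shows "(nderiv n u has_real_derivative nderiv (Suc n) u x) (at x)" (is ?A)
    and "nderiv (n + 2) u x =
        (\<epsilon>2 * leibniz_sum n (\<lambda>k. nderiv k b) (\<lambda>k. nderiv (Suc k) u) x
         + leibniz_sum n (\<lambda>k. nderiv k c) (\<lambda>k. nderiv k u) x - nderiv n f x) / \<epsilon>1" (is ?B)
proof -
  define D where "D n \<longleftrightarrow> (\<forall>x\<in>{0<..<1}.
      (nderiv n u has_real_derivative nderiv (Suc n) u x) (at x))" for n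
  define R where "R n x = (\<epsilon>2 * leibniz_sum n (\<lambda>k. nderiv k b) (\<lambda>k. nderiv (Suc k) u) x
         + leibniz_sum n (\<lambda>k. nderiv k c) (\<lambda>k. nderiv k u) x - nderiv n f x) / \<epsilon>1" for n x
  \<comment> \<open>\<open>R n\<close> contains derivatives of \<open>u\<close> up to order
    \<open>Suc n\<close>, so \<open>D j\<close> for all \<open>j \<le> Suc n\<close> is exactly what
    differentiating it requires.\<close>
  have *: "(\<forall>j\<le>Suc n. D j) \<and> (\<forall>x\<in>{0<..<1}. nderiv (n + 2) u x = R n x)" for n
  proof (induction n)
    case 0
    have "D 0" "D 1"
      using sol nderiv_has_derivative[of 0 u] nderiv_has_derivative[of 1 u]
      by (auto simp: D_def bvp_solution_def nderiv_0)
    moreover have "nderiv 2 u x = R 0 x" if "x \<in> {0<..<1}" for x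
    proof -
      have "- \<epsilon>1 * nderiv 2 u x + \<epsilon>2 * b x * nderiv 1 u x + c x * u x = f x"
        using sol that by (simp add: bvp_solution_def)
      then show ?thesis
        using e1 by (simp add: R_def leibniz_sum_def nderiv_0 field_simps)
    qed
    ultimately show ?case
      by (auto simp: le_Suc_eq numeral_2_eq_2)
  next
    case (Suc n)
    have dR: "(R n has_real_derivative R (Suc n) x) (at x)" if x: "x \<in> {0<..<1}" for x
    proof -
      have "(leibniz_sum n (\<lambda>k. nderiv k b) (\<lambda>k. nderiv (Suc k) u) has_real_derivative
          leibniz_sum (Suc n) (\<lambda>k. nderiv k b) (\<lambda>k. nderiv (Suc k) u) x) (at x)"
        using Suc x by (intro leibniz_sum_has_derivative b) (auto simp: D_def)
      moreover have "(leibniz_sum n (\<lambda>k. nderiv k c) (\<lambda>k. nderiv k u) has_real_derivative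
          leibniz_sum (Suc n) (\<lambda>k. nderiv k c) (\<lambda>k. nderiv k u) x) (at x)"
        using Suc x by (intro leibniz_sum_has_derivative c) (auto simp: D_def)
      ultimately show ?thesis
        unfolding R_def by (intro DERIV_cdivide DERIV_diff DERIV_add DERIV_cmult f x)
    qed
    have dU: "(nderiv (n + 2) u has_real_derivative R (Suc n) x) (at x)"
      if x: "x \<in> {0<..<1}" for x
    proof (rule has_field_derivative_transform_within_open[OF dR[OF x], of "{0<..<1}"])
      show "R n y = nderiv (n + 2) u y" if "y \<in> {0<..<1}" for y
        using Suc that by auto
    qed (use x in auto)
    \<comment> \<open>Differentiability has to come first, as it makes
      \<open>nderiv (Suc n + 2) u\<close> a true derivative; uniqueness of derivatives then
      identifies it with \<open>R (Suc n)\<close>.\<close>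
    then have "nderiv (n + 2) u differentiable_on {0<..<1}"
      by (meson differentiable_at_withinI differentiable_on_def real_differentiable_def)
    then have D: "D (n + 2)"
      unfolding D_def by (auto intro!: nderiv_has_derivative)
    then have "nderiv (Suc n + 2) u x = R (Suc n) x" if "x \<in> {0<..<1}" for x
      using dU[OF that] that DERIV_unique unfolding D_def by fastforce
    with Suc D show ?case
      by (auto simp: le_Suc_eq)
  qed
  show ?A
    using *[of n] x by (auto simp: D_def)
  show ?B
    using *[of n] x by (auto simp: R_def)
qed

section \<open>Induction for the higher derivatives\<close>

text \<open>Passing from order \<open>n - 1\<close> to \<open>n\<close> gains one factor
  \<open>K\<close> and one factor \<open>max (real n) (1 / e1)\<close>. The latter pays for the
  division by \<open>e1\<close>, the former for the coefficients: the two Leibniz sums contribute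
  \<open>2 * A\<close> each and \<open>f\<close> contributes \<open>A\<close>, whence
  \<open>5 * A \<le> K\<close>.\<close>

lemma ode_recursion_bound:
  fixes U b c f :: "nat \<Rightarrow> real \<Rightarrow> real"
  assumes e: "0 < e1" "0 \<le> e2" "e1 \<le> 1" "e2 \<le> 1"
    and b: "\<And>k. \<bar>b k x\<bar> \<le> A * fact k * rb ^ k"
    and c: "\<And>k. \<bar>c k x\<bar> \<le> A * fact k * rc ^ k"
    and f: "\<And>k. \<bar>f k x\<bar> \<le> A * fact k * rf ^ k"
    and rec: "\<And>n. U (n + 2) x =
        (e2 * leibniz_sum n b (\<lambda>k. U (Suc k)) x + leibniz_sum n c U x - f n x) / e1"
    and U0: "\<bar>U 0 x\<bar> \<le> C" and U1: "\<bar>U 1 x\<bar> \<le> C * K / e1"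
    and C: "1 \<le> C" and A: "0 \<le> A" and r: "0 \<le> rb" "0 \<le> rc" "0 \<le> rf"
    and K: "1 \<le> K" "2 * rb \<le> K" "2 * rc \<le> K" "rf \<le> K" "5 * A \<le> K"
  shows "\<bar>U n x\<bar> \<le> C * K ^ n * max (real n) (1 / e1) ^ n"
proof (induction n rule: less_induct)
  case (less n)
  have e1: "1 \<le> 1 / e1"
    using e by simp
  consider "n = 0" | "n = 1" | k where "n = k + 2"
    by (metis One_nat_def add_2_eq_Suc' not0_implies_Suc)
  then show ?case
  proof cases
    case 1
    then show ?thesis using U0 by simp
  next
    case 2
    have "C * K / e1 \<le> C * K * max 1 (1 / e1)"
      using e1 by (simp add: max_def)
    then show ?thesis using U1 2 by simp
  next
    case (3 k)
    define m where "m = max (real n) (1 / e1)"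
    have m: "1 \<le> m" "1 / e1 \<le> m" "real k \<le> m"
      using e1 3 by (auto simp: m_def)
    \<comment> \<open>The maximum grows with the order, so all lower orders can share the base
      \<open>m\<close> of order \<open>n\<close>, as \<open>leibniz_sum_bound\<close>
      demands.\<close>
    have IH: "\<bar>U j x\<bar> \<le> C * (K * m) ^ j" if "j < n" for j
    proof -
      have "C * K ^ j * max (real j) (1 / e1) ^ j \<le> C * K ^ j * m ^ j"
        using that C K e1 by (intro mult_left_mono power_mono) (auto simp: m_def)
      then show ?thesis
        using less.IH[OF that] by (simp add: power_mult_distrib mult.assoc)
    qed
    have Km: "1 \<le> K * m"
      using K(1) m(1) mult_mono[of 1 K 1 m] by simp
    \<comment> \<open>This is the bound at order \<open>k + 1\<close>, the highest on the right of
      the recursion. The terms from \<open>c\<close> and \<open>f\<close> reach only power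
      \<open>k\<close> and are raised to it by \<open>1 \<le> K * m\<close>.\<close>
    define P where "P = C * (K * m) ^ Suc k"
    have P: "C * (K * m) ^ k \<le> P"
      unfolding P_def using C Km by (intro mult_left_mono power_increasing) auto
    have P0: "0 \<le> P"
      unfolding P_def using C Km by auto
    have "\<bar>leibniz_sum k b (\<lambda>j. U (Suc j)) x\<bar> \<le> 2 * A * (C * (K * m)) * (K * m) ^ k"
    proof (rule leibniz_sum_bound[where r = rb])
      show "\<bar>U (Suc j) x\<bar> \<le> C * (K * m) * (K * m) ^ j" if "j \<le> k" for j
        using IH[of "Suc j"] 3 that by (simp add: mult.assoc)
    qed (use b A r K C Km m(3) in auto)
    then have Lb: "\<bar>leibniz_sum k b (\<lambda>j. U (Suc j)) x\<bar> \<le> 2 * A * P"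
      by (simp add: P_def mult_ac)
    have "\<bar>e2 * leibniz_sum k b (\<lambda>j. U (Suc j)) x\<bar> \<le> \<bar>leibniz_sum k b (\<lambda>j. U (Suc j)) x\<bar>"
      using e by (simp add: abs_mult mult_left_le_one_le)
    note Lb = order_trans[OF this Lb]
    have "\<bar>leibniz_sum k c U x\<bar> \<le> 2 * A * C * (K * m) ^ k"
      using IH 3 C K c A r m(3) by (intro leibniz_sum_bound[where r = rc]) auto
    also have "\<dots> \<le> 2 * A * P"
      using mult_left_mono[OF P, of "2 * A"] A by (simp add: mult_ac)
    finally have Lc: "\<bar>leibniz_sum k c U x\<bar> \<le> 2 * A * P" .
    have "\<bar>f k x\<bar> \<le> A * (fact k * rf ^ k)"
      using f[of k] by (simp add: mult.assoc)
    also have "\<dots> \<le> A * (m ^ k * K ^ k)"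
    proof (intro mult_left_mono mult_mono power_mono)
      \<comment> \<open>The case \<open>n = k\<close> of the binomial estimate gives
        \<open>fact k \<le> k ^ k\<close>.\<close>
      show "fact k \<le> m ^ k"
        using choose_mult_fact_le_power[of k k] power_mono[OF m(3), of k] by simp
    qed (use A r K m in auto)
    also have "\<dots> \<le> A * (C * (K * m) ^ k)"
    proof (intro mult_left_mono)
      show "m ^ k * K ^ k \<le> C * (K * m) ^ k"
        using C K(1) m(1) mult_right_mono[of 1 C "(K * m) ^ k"]
        by (simp add: power_mult_distrib mult_ac)
    qed (use A in auto)
    also have "\<dots> \<le> A * P"
      using P A by (intro mult_left_mono)
    finally have Lf: "\<bar>f k x\<bar> \<le> A * P" .
    have "\<bar>U n x\<bar> = \<bar>e2 * leibniz_sum k b (\<lambda>k. U (Suc k)) x + leibniz_sum k c U x - f k x\<bar> * (1 / e1)"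
      using rec[of k] 3 e by simp
    also have "\<dots> \<le> (K * P) * m"
    proof (intro mult_mono m)
      have "5 * (A * P) \<le> K * P"
        using mult_right_mono[OF K(5) P0] by (simp add: mult.assoc)
      then show "\<bar>e2 * leibniz_sum k b (\<lambda>k. U (Suc k)) x + leibniz_sum k c U x - f k x\<bar> \<le> K * P"
        using Lb Lc Lf by (simp add: mult.assoc)
    qed (use K P0 e in auto)
    also have "\<dots> = C * (K * m) ^ n"
      using 3 by (simp add: P_def mult_ac)
    finally show ?thesis
      by (simp add: m_def power_mult_distrib mult.assoc)
  qed
qed

section \<open>Choice of constants and conclusion\<close>

theorem theorem2:
  fixes b c f :: "real \<Rightarrow> real"
    and C0 \<gamma>f \<gamma>c \<gamma>b \<beta>0 \<gamma> \<rho> :: real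
  assumes "C0 > 0" and "\<gamma>f > 0" and "\<gamma>c > 0" and "\<gamma>b > 0"
    and "\<beta>0 > 0" and "\<gamma> > 0" and "\<rho> > 0"
    and "analytic_data C0 \<gamma>f f"
    and "analytic_data C0 \<gamma>c c"
    and "analytic_data C0 \<gamma>b b"
    and "\<forall>x\<in>{0..1}. b x \<ge> \<beta>0"
    and "\<forall>x\<in>{0..1}. c x \<ge> \<gamma>"
  shows "\<exists>C>0. \<exists>K>0. \<forall>\<epsilon>1 \<epsilon>2. \<forall>u :: real \<Rightarrow> real.
           0 < \<epsilon>1 \<longrightarrow> \<epsilon>1 \<le> \<epsilon>2 \<longrightarrow> \<epsilon>2 \<le> 1 \<longrightarrow>
           (\<forall>x\<in>{0..1}. c x - \<epsilon>2 / 2 * nderiv 1 b x \<ge> \<rho>) \<longrightarrow>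
           bvp_solution \<epsilon>1 \<epsilon>2 b c f u \<longrightarrow>
           (\<forall>n. nderiv n u differentiable_on {0<..<1} \<and>
                Linf_norm (nderiv n u) \<le> ereal (C * K ^ n * max (real n) (1 / \<epsilon>1) ^ n))"
proof -
  note pos = assms(1-7)
  note bd = analytic_data_bound[OF assms(8)] analytic_data_bound[OF assms(9)]
    analytic_data_bound[OF assms(10)]
  note der = analytic_data_has_derivative[OF assms(10)] analytic_data_has_derivative[OF assms(9)]
    analytic_data_has_derivative[OF assms(8)]
  \<comment> \<open>\<open>M\<close> is the maximum principle bound for \<open>u\<close>, and
    \<open>B\<close> is the numerator in \<open>first_derivative_bound\<close> with all bounds set
    to \<open>C0\<close>, except \<open>C0 * \<gamma>b\<close> for \<open>b'\<close>. Each summand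
    of \<open>K\<close> secures one lower bound on \<open>K\<close>; the summand \<open>B\<close>
    serves the start of the recursion at order 1. None of these constants involves
    \<open>\<epsilon>1\<close>, \<open>\<epsilon>2\<close> or \<open>u\<close>.\<close>
  define M where "M = C0 / \<gamma>"
  define B where "B = C0 * M + C0 + C0 * \<gamma>b * M + 2 * (C0 * M)"
  define C where "C = 1 + M"
  define K where "K = 1 + 2 * \<gamma>b + 2 * \<gamma>c + \<gamma>f + 5 * C0 + B"
  have M: "0 < M" and B: "0 < B"
    using pos by (auto simp: M_def B_def intro!: add_pos_pos mult_pos_pos)
  have C: "1 \<le> C" and K: "1 \<le> K" "2 * \<gamma>b \<le> K" "2 * \<gamma>c \<le> K" "\<gamma>f \<le> K" "5 * C0 \<le> K" "B \<le> K"
    using pos M B by (auto simp: C_def K_def)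
  have "nderiv n u differentiable_on {0<..<1} \<and>
      Linf_norm (nderiv n u) \<le> ereal (C * K ^ n * max (real n) (1 / \<epsilon>1) ^ n)"
    if e: "0 < \<epsilon>1" "\<epsilon>1 \<le> \<epsilon>2" "\<epsilon>2 \<le> 1" and sol: "bvp_solution \<epsilon>1 \<epsilon>2 b c f u" for \<epsilon>1 \<epsilon>2 u n
  proof -
    have U: "(nderiv n u has_real_derivative nderiv (Suc n) u x) (at x)"
      "nderiv (n + 2) u x =
        (\<epsilon>2 * leibniz_sum n (\<lambda>k. nderiv k b) (\<lambda>k. nderiv (Suc k) u) x
         + leibniz_sum n (\<lambda>k. nderiv k c) (\<lambda>k. nderiv k u) x - nderiv n f x) / \<epsilon>1"
      if "x \<in> {0<..<1}" for n x
      using bvp_solution_derivatives[OF sol e(1) _ _ _ that] der by auto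
    have u: "continuous_on {0..1} u" and u0: "u 0 = 0" "u 1 = 0"
      using sol by (auto simp: bvp_solution_def)
    have eq: "- \<epsilon>1 * nderiv 2 u x + \<epsilon>2 * b x * nderiv 1 u x + c x * u x = f x"
      if "x \<in> {0<..<1}" for x
      using sol that by (simp add: bvp_solution_def)
    have du: "(u has_real_derivative nderiv 1 u x) (at x)" if "x \<in> {0<..<1}" for x
      using U(1)[OF that, of 0] by (simp add: nderiv_0)
    have dv: "(nderiv 1 u has_real_derivative nderiv 2 u x) (at x)" if "x \<in> {0<..<1}" for x
      using U(1)[OF that, of 1] by (simp add: numeral_2_eq_2)
    have uM: "\<bar>u x\<bar> \<le> M" if "x \<in> {0<..<1}" for x
      unfolding M_def using assms that bd(1)[of _ 0]
      by (intro maximum_principle_abs[OF u u0 du dv eq e(1)]) (auto simp: nderiv_0)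
    have u1: "\<bar>nderiv 1 u x\<bar> \<le> B / \<epsilon>1" if x: "x \<in> {0<..<1}" for x
      unfolding B_def
    proof (rule first_derivative_bound[OF u u0 du dv _ eq e(1) _ e(3) uM _ _ _ _ x])
      fix y :: real assume y: "y \<in> {0<..<1}"
      show "(b has_real_derivative nderiv 1 b y) (at y)"
        using der(1)[OF y, of 0] by (simp add: nderiv_0)
      show "\<bar>b y\<bar> \<le> C0" "\<bar>c y\<bar> \<le> C0" "\<bar>f y\<bar> \<le> C0" "\<bar>nderiv 1 b y\<bar> \<le> C0 * \<gamma>b"
        using bd(1,2,3)[OF y, of 0] bd(3)[OF y, of 1] by (auto simp: nderiv_0)
    qed (use e in auto)
    have bound: "\<bar>nderiv n u x\<bar> \<le> C * K ^ n * max (real n) (1 / \<epsilon>1) ^ n"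
      if x: "x \<in> {0<..<1}" for x
    proof (rule ode_recursion_bound[where U = "\<lambda>n. nderiv n u" and b = "\<lambda>n. nderiv n b"
          and c = "\<lambda>n. nderiv n c" and f = "\<lambda>n. nderiv n f" and A = C0, OF e(1) _ _ e(3)
          bd(3)[OF x] bd(2)[OF x] bd(1)[OF x] U(2)[OF x]])
      show "\<bar>nderiv 0 u x\<bar> \<le> C"
        using uM[OF x] by (simp add: C_def nderiv_0)
      have "B \<le> C * K"
        using K C mult_mono[of 1 C B K] B by simp
      then have "B / \<epsilon>1 \<le> C * K / \<epsilon>1"
        using e by (intro divide_right_mono) auto
      then show "\<bar>nderiv 1 u x\<bar> \<le> C * K / \<epsilon>1"
        using u1[OF x] by linarith
    qed (use e K C pos in auto)
    have "nderiv n u differentiable_on {0<..<1}"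
      using U(1) by (meson differentiable_at_withinI differentiable_on_def real_differentiable_def)
    then show ?thesis
      using bound by (auto intro!: Linf_norm_leI differentiable_imp_continuous_on)
  qed
  moreover have "0 < C" "0 < K"
    using C K by auto
  ultimately show ?thesis
    by blast
qed

end
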